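(* Let $p$ be a prime with $p\equiv 3\pmod 4$ and let $\mathbb{F}_p$ be the field with $p$ elements. For $K\in\mathbb{F}_p$ let $C_K=\{(u,v)\in\mathbb{F}_p^2: u^2+v^2=K\}$. Let $U_1,U_2,\dots$ be i.i.d. uniformly distributed on $C_1$, and let $X_0=(0,0)$, $X_n=U_1+\cdots+U_n$. Write $c_1^n=\sum_{j=0}^{p-1}\alpha_{n,j}c_j$ with $\alpha_{n,j}=\Pr(X_n\in C_j)$. Then $$\lim_{n\to\infty} c_1^n=\frac{1}{p^2}c_0+\frac{p+1}{p^2}(c_1+c_2+\cdots+c_{p-1}),$$ i.e. $\lim_{n\to\infty}\alpha_{n,0}=\frac1{p^2}$ and $\lim_{n\to\infty}\alpha_{n,j}=\frac{p+1}{p^2}$ for $j=1,\dots,p-1$. Equivalently, for the Markov chain on the set of circles $\{c_0,\dots,c_{p-1}\}$ with transition kernel $K(c_i,c_j)=n_{i1}^j$, one has $K^n(c_i,c_j)\to\pi(c_j)$ for all $i,j$, where $\pi(c_0)=1/p^2$ and $\pi(c_j)=(p+1)/p^2$ for $j\neq 0$.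
   Context: Here $n_{ij}^k=N_{ij}^k/(|C_i||C_j|)$ with $N_{ij}^k=\#\{(a,b)\in C_i\times C_j: a+b\in C_k\}$; $n_{i1}^j$ is the probability that a point uniformly distributed on $C_i$, translated by a uniform point of $C_1$, lands on $C_j$. $c_j$ is a formal symbol for the circle $C_j$. *)

theory Defs
  imports "HOL-Probability.Probability" "HOL-Number_Theory.Cong"
begin

definition circle :: "'a::field \<Rightarrow> ('a \<times> 'a) set" where
  "circle K = {(u, v). u\<^sup>2 + v\<^sup>2 = K}"

definition N_coeff :: "'a::field \<Rightarrow> 'a \<Rightarrow> 'a \<Rightarrow> nat" where
  "N_coeff i j k = card {(a, b) \<in> circle i \<times> circle j. a + b \<in> circle k}"

definition n_coeff :: "'a::field \<Rightarrow> 'a \<Rightarrow> 'a \<Rightarrow> real" where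
  "n_coeff i j k = real (N_coeff i j k) / (real (card (circle i)) * real (card (circle j)))"

definition walk :: "(nat \<Rightarrow> 'w \<Rightarrow> 'a::field \<times> 'a) \<Rightarrow> nat \<Rightarrow> 'w \<Rightarrow> 'a \<times> 'a" where
  "walk U n \<omega> = (\<Sum>i=1..n. U i \<omega>)"

definition alpha :: "'w measure \<Rightarrow> (nat \<Rightarrow> 'w \<Rightarrow> 'a::field \<times> 'a) \<Rightarrow> nat \<Rightarrow> 'a \<Rightarrow> real" where
  "alpha M U n j = measure M {\<omega> \<in> space M. walk U n \<omega> \<in> circle j}"

text \<open>Formal real combinations of the circles are vectors indexed by the field elements;
  the formal symbol of a circle is the corresponding basis vector.\<close>

definition circle_sym :: "'a \<Rightarrow> real ^ 'a::{field,finite}" where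
  "circle_sym j = axis j 1"

definition c1_power ::
    "'w measure \<Rightarrow> (nat \<Rightarrow> 'w \<Rightarrow> 'a \<times> 'a) \<Rightarrow> nat \<Rightarrow> real ^ 'a::{field,finite}" where
  "c1_power M U n = (\<Sum>j\<in>UNIV. alpha M U n j *\<^sub>R circle_sym j)"

definition circle_kernel :: "real ^ 'a::{field,finite} ^ 'a::{field,finite}" where
  "circle_kernel = (\<chi> i j. n_coeff i 1 j)"

text \<open>The power operator on this matrix type is not the matrix power, so the
  \<open>n\<close>-step kernel is written as an iterated matrix product.\<close>

definition circle_kernel_pow :: "nat \<Rightarrow> real ^ 'a::{field,finite} ^ 'a::{field,finite}" where
  "circle_kernel_pow n = ((\<lambda>A. A ** circle_kernel) ^^ n) (mat 1)"

definition circle_stationary :: "'a::{field,finite} \<Rightarrow> real" where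
  "circle_stationary j =
     (if j = 0 then 1 / (real CARD('a))\<^sup>2 else (real CARD('a) + 1) / (real CARD('a))\<^sup>2)"

end

theory Submission
  imports Defs "HOL-Number_Theory.Residues"
begin

text \<open>
  Let \<open>T f x\<close> be the average of \<open>f (x + b)\<close> over \<open>b\<close> in the unit circle of the plane over the
  field. Every point is reached from every other one in exactly \<open>2(p - 1)\<close> unit steps, since a sum
  of \<open>p - 1\<close> signs takes all values modulo the odd prime \<open>p\<close>. Hence \<open>T\<^bsup>2(p-1)\<^esup>\<close> shrinks the
  oscillation of every function by a fixed factor, and as \<open>T\<close> preserves sums, \<open>T\<^bsup>n\<^esup> f\<close> tends to
  the mean of \<open>f\<close>. For \<open>f\<close> the indicator of a circle \<open>C\<^sub>j\<close>, this mean is \<open>|C\<^sub>j| / p\<^sup>2\<close>, the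
  value of \<open>T\<^bsup>n\<^esup> f\<close> at the origin is \<open>\<alpha>\<^sub>n\<^sub>,\<^sub>j\<close>, and its value at any point of \<open>C\<^sub>i\<close> is the
  \<open>n\<close>-step kernel from \<open>c\<^sub>i\<close> to \<open>c\<^sub>j\<close>, because rotations act transitively on each circle. As
  \<open>-1\<close> is not a square, \<open>C\<^sub>0\<close> is a single point and the other circles have \<open>p + 1\<close> points each.
\<close>

section \<open>Averaging operators on finite abelian groups\<close>

definition avg_step :: "'g set \<Rightarrow> ('g::ab_group_add \<Rightarrow> real) \<Rightarrow> 'g \<Rightarrow> real" where
  "avg_step S f x = (\<Sum>b\<in>S. f (x + b)) / real (card S)"

lemma avg_step_ge:
  fixes S :: "'g::{ab_group_add,finite} set"
  assumes "S \<noteq> {}" and "\<And>x. a \<le> f x"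
  shows "a \<le> avg_step S f x"
proof -
  have "card S > 0" using assms(1) by (simp add: card_gt_0_iff)
  moreover have "real (card S) * a \<le> (\<Sum>b\<in>S. f (x + b))"
    using assms(2) by (intro sum_bounded_below) auto
  ultimately show ?thesis by (simp add: avg_step_def field_simps)
qed

lemma avg_step_le:
  fixes S :: "'g::{ab_group_add,finite} set"
  assumes "S \<noteq> {}" and "\<And>x. f x \<le> a"
  shows "avg_step S f x \<le> a"
proof -
  have "card S > 0" using assms(1) by (simp add: card_gt_0_iff)
  moreover have "(\<Sum>b\<in>S. f (x + b)) \<le> real (card S) * a"
    using assms(2) by (intro sum_bounded_above) auto
  ultimately show ?thesis by (simp add: avg_step_def field_simps)
qed

lemma avg_step_diff_const:
  fixes S :: "'g::{ab_group_add,finite} set"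
  assumes "S \<noteq> {}"
  shows "avg_step S (\<lambda>x. f x - c) = (\<lambda>x. avg_step S f x - c)"
  using assms by (auto simp: avg_step_def sum_subtractf field_simps fun_eq_iff)

lemma funpow_avg_step_diff_const:
  fixes S :: "'g::{ab_group_add,finite} set"
  assumes "S \<noteq> {}"
  shows "(avg_step S ^^ n) (\<lambda>x. f x - c) = (\<lambda>x. (avg_step S ^^ n) f x - c)"
  using assms by (induction n) (simp_all add: avg_step_diff_const)

lemma funpow_avg_step_bounds:
  fixes S :: "'g::{ab_group_add,finite} set"
  assumes "S \<noteq> {}" and "\<And>x. a \<le> f x" and "\<And>x. f x \<le> b"
  shows "a \<le> (avg_step S ^^ n) f x \<and> (avg_step S ^^ n) f x \<le> b"
  by (induction n arbitrary: x) (auto intro!: avg_step_le avg_step_ge assms)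

text \<open>Translation by a fixed \<open>b\<close> permutes the group, so each \<open>b\<close> in
  \<open>S\<close> contributes the full sum. Invariance of the sum identifies the limit of the
  iterates as the mean.\<close>

lemma sum_avg_step:
  fixes S :: "'g::{ab_group_add,finite} set"
  assumes "S \<noteq> {}"
  shows "(\<Sum>x\<in>UNIV. avg_step S f x) = (\<Sum>x\<in>UNIV. f x)"
proof -
  have "(\<Sum>x\<in>UNIV. f (x + b)) = (\<Sum>x\<in>UNIV. f x)" for b
    by (rule sum.reindex_bij_witness[of _ "\<lambda>x. x - b" "\<lambda>x. x + b"]) auto
  then have "(\<Sum>x\<in>UNIV. \<Sum>b\<in>S. f (x + b)) = real (card S) * (\<Sum>x\<in>UNIV. f x)"
    by (subst sum.swap) simp
  then show ?thesis
    using assms by (simp add: avg_step_def flip: sum_divide_distrib)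
qed

lemma sum_funpow_avg_step:
  fixes S :: "'g::{ab_group_add,finite} set"
  assumes "S \<noteq> {}"
  shows "(\<Sum>x\<in>UNIV. (avg_step S ^^ n) f x) = (\<Sum>x\<in>UNIV. f x)"
  using assms by (induction n) (simp_all add: sum_avg_step)

section \<open>Reachability and contraction of the oscillation\<close>

definition step_rel :: "'g::ab_group_add set \<Rightarrow> 'g rel" where
  "step_rel S = {(x, y). y - x \<in> S}"

text \<open>The iterate averages \<open>f\<close> over the endpoints of \<open>card S ^ n\<close>
  equally weighted step sequences. At least one of them ends at \<open>y\<close>, and nonnegativity
  allows all others to be dropped. The relation power counts steps exactly, as this needs.\<close>

lemma funpow_avg_step_ge_reachable:
  fixes S :: "'g::{ab_group_add,finite} set"
  assumes "S \<noteq> {}" and "\<And>x. 0 \<le> f x" and "(x, y) \<in> step_rel S ^^ n"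
  shows "f y / real (card S) ^ n \<le> (avg_step S ^^ n) f x"
  using assms(3)
proof (induction n arbitrary: x)
  case 0
  then show ?case by simp
next
  case (Suc n)
  from Suc.prems obtain z where z: "(x, z) \<in> step_rel S" "(z, y) \<in> step_rel S ^^ n"
    by (rule relpow_Suc_E2)
  let ?g = "(avg_step S ^^ n) f"
  have "f y / real (card S) ^ n \<le> ?g (x + (z - x))"
    using Suc.IH[OF z(2)] by simp
  also have "\<dots> \<le> (\<Sum>b\<in>S. ?g (x + b))"
  proof (rule member_le_sum[where f = "\<lambda>b. ?g (x + b)"])
    have "0 \<le> ?g w" for w
      by (induction n arbitrary: w) (auto intro!: avg_step_ge assms)
    then show "0 \<le> ?g (x + b)" for b .
  qed (use z in \<open>auto simp: step_rel_def\<close>)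
  finally have "f y / real (card S) ^ n / real (card S) \<le> avg_step S ?g x"
    unfolding avg_step_def[of S ?g] by (rule divide_right_mono) simp
  then show ?case by (simp add: mult.commute)
qed

definition osc :: "('g::finite \<Rightarrow> real) \<Rightarrow> real" where
  "osc f = Max (range f) - Min (range f)"

lemma osc_le:
  assumes "\<And>x. a \<le> f x" and "\<And>x. f x \<le> b"
  shows "osc f \<le> b - a"
proof -
  have "a \<le> Min (range f)" "Max (range f) \<le> b"
    using assms by auto
  then show ?thesis unfolding osc_def by linarith
qed

lemma Min_range_le: "Min (range f) \<le> f x" for f :: "'g::finite \<Rightarrow> real"
  by simp

lemma Max_range_ge: "f x \<le> Max (range f)" for f :: "'g::finite \<Rightarrow> real"
  by simp

lemma osc_nonneg: "0 \<le> osc f"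
  unfolding osc_def using Min_range_le[of f undefined] Max_range_ge[of f undefined] by linarith

text \<open>A value and the mean both lie between the minimum and the maximum, so convergence to the
  mean reduces to a vanishing oscillation.\<close>

lemma diff_mean_le_osc:
  fixes f :: "'g::finite \<Rightarrow> real"
  shows "\<bar>f x - (\<Sum>y\<in>UNIV. f y) / real CARD('g)\<bar> \<le> osc f"
proof -
  let ?m = "(\<Sum>y\<in>UNIV. f y) / real CARD('g)"
  have "real CARD('g) * Min (range f) \<le> (\<Sum>y\<in>UNIV. f y)"
    by (rule sum_bounded_below) (rule Min_range_le)
  moreover have "(\<Sum>y\<in>UNIV. f y) \<le> real CARD('g) * Max (range f)"
    by (rule sum_bounded_above) (rule Max_range_ge)
  ultimately have "Min (range f) \<le> ?m" "?m \<le> Max (range f)"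
    by (simp_all add: field_simps)
  with Min_range_le[of f x] Max_range_ge[of f x] show ?thesis
    unfolding osc_def by linarith
qed

lemma osc_funpow_avg_step_le:
  fixes S :: "'g::{ab_group_add,finite} set"
  assumes "S \<noteq> {}"
  shows "osc ((avg_step S ^^ n) f) \<le> osc f"
  unfolding osc_def[of f]
  by (rule osc_le; rule funpow_avg_step_bounds[OF assms, THEN conjunct1]
      funpow_avg_step_bounds[OF assms, THEN conjunct2]; rule Min_range_le Max_range_ge)

text \<open>From every start, \<open>N\<close> steps give weight at least
  \<open>1 / card S ^ N\<close> to a point where \<open>f\<close> is maximal. This raises the
  minimum by that fraction of \<open>osc f\<close>, while the maximum does not grow.\<close>

lemma osc_funpow_avg_step_contract:
  fixes S :: "'g::{ab_group_add,finite} set"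
  assumes "S \<noteq> {}" and "\<And>x y. (x, y) \<in> step_rel S ^^ N"
  shows "osc ((avg_step S ^^ N) f) \<le> (1 - 1 / real (card S) ^ N) * osc f"
proof -
  let ?e = "1 / real (card S) ^ N" and ?m = "Min (range f)"
  obtain y where y: "f y = Max (range f)"
    using Max_in[of "range f"] by (metis UNIV_not_empty finite finite_imageI image_is_empty imageE)
  \<comment> \<open>Subtracting the minimum makes the function nonnegative, so the reachability
    bound applies; its value at \<open>y\<close> is then \<open>osc f\<close>.\<close>
  have "?e * osc f \<le> (avg_step S ^^ N) f x - ?m" for x
    using funpow_avg_step_ge_reachable[OF assms(1) _ assms(2), of "\<lambda>x. f x - ?m" y x]
      Min_range_le[of f]
    by (simp add: funpow_avg_step_diff_const[OF assms(1)] y osc_def)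
  then have "?m + ?e * osc f \<le> (avg_step S ^^ N) f x" for x
    by (simp add: algebra_simps)
  moreover have "(avg_step S ^^ N) f x \<le> Max (range f)" for x
    by (rule funpow_avg_step_bounds[OF assms(1), THEN conjunct2]; rule Min_range_le Max_range_ge)
  ultimately have "osc ((avg_step S ^^ N) f) \<le> Max (range f) - (?m + ?e * osc f)"
    by (rule osc_le)
  then show ?thesis by (simp add: osc_def algebra_simps)
qed

theorem funpow_avg_step_tendsto_mean:
  fixes S :: "'g::{ab_group_add,finite} set"
  assumes "S \<noteq> {}" and "\<And>x y. (x, y) \<in> step_rel S ^^ N"
  shows "(\<lambda>n. (avg_step S ^^ n) f x) \<longlonglongrightarrow> (\<Sum>y\<in>UNIV. f y) / real CARD('g)"
proof -
  define a where "a n = osc ((avg_step S ^^ n) f)" for n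
  let ?e = "1 / real (card S) ^ N"
  have e: "?e > 0" using assms(1) by (simp add: card_gt_0_iff)
  have "a (m + n) \<le> a n" for m n
    unfolding a_def funpow_add o_def by (rule osc_funpow_avg_step_le[OF assms(1)])
  then have "decseq a"
    by (metis decseq_def le_add_diff_inverse2)
  then obtain L where L: "a \<longlonglongrightarrow> L" "L \<ge> 0"
    using decseq_convergent[of a 0] osc_nonneg by (metis LIMSEQ_le_const a_def)
  have "a (n + N) \<le> (1 - ?e) * a n" for n
    unfolding a_def add.commute[of n N] funpow_add o_def
    by (rule osc_funpow_avg_step_contract[OF assms])
  \<comment> \<open>Contraction is known only across blocks of \<open>N\<close> steps. Monotonicity
    provides a limit \<open>L\<close>, and the block inequality passes to it, which leaves only
    \<open>L = 0\<close>.\<close>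
  then have "L \<le> (1 - ?e) * L"
    by (intro LIMSEQ_le[OF LIMSEQ_ignore_initial_segment[OF L(1), of N]
          tendsto_mult_left[OF L(1)]]) auto
  then have "?e * L \<le> 0" by (simp add: algebra_simps)
  with e L(2) have "L = 0"
    by (metis antisym mult_le_0_iff not_less)
  with L have "a \<longlonglongrightarrow> 0" by simp
  then have "(\<lambda>n. (avg_step S ^^ n) f x - (\<Sum>y\<in>UNIV. f y) / real CARD('g)) \<longlonglongrightarrow> 0"
  proof (rule Lim_null_comparison[rotated], intro always_eventually allI)
    fix n
    show "norm ((avg_step S ^^ n) f x - (\<Sum>y\<in>UNIV. f y) / real CARD('g)) \<le> a n"
      using diff_mean_le_osc[of "(avg_step S ^^ n) f" x]
      by (simp add: a_def sum_funpow_avg_step[OF assms(1)])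
  qed
  then show ?thesis by (simp add: LIM_zero_iff)
qed

section \<open>Circles over a finite prime field\<close>

definition qnorm :: "'a::field \<times> 'a \<Rightarrow> 'a" where
  "qnorm x = (fst x)\<^sup>2 + (snd x)\<^sup>2"

text \<open>Multiplication of u + v i with i^2 = -1, for which \<open>qnorm\<close> is the norm.
  Elements of norm 1 act as the rotations.\<close>

definition cmul :: "'a::field \<times> 'a \<Rightarrow> 'a \<times> 'a \<Rightarrow> 'a \<times> 'a" where
  "cmul z x = (fst z * fst x - snd z * snd x, fst z * snd x + snd z * fst x)"

lemma circle_iff: "x \<in> circle k \<longleftrightarrow> qnorm x = k"
  by (cases x) (simp add: circle_def qnorm_def)

lemma qnorm_cmul: "qnorm (cmul z x) = qnorm z * qnorm x"
  by (simp add: qnorm_def cmul_def power2_eq_square algebra_simps)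

lemma cmul_add: "cmul z (x + y) = cmul z x + cmul z y"
  by (simp add: cmul_def algebra_simps)

text \<open>Multiplying by the conjugate of \<open>z\<close> turns \<open>cmul z w\<close> into
  \<open>w\<close> scaled by \<open>qnorm z\<close>, which is invertible.\<close>

lemma cmul_cancel:
  assumes "qnorm z \<noteq> 0" and "cmul z x = cmul z y"
  shows "x = y"
proof -
  have *: "cmul (fst z, - snd z) (cmul z w) = (qnorm z * fst w, qnorm z * snd w)" for w
    by (simp add: cmul_def qnorm_def power2_eq_square algebra_simps)
  have "(qnorm z * fst x, qnorm z * snd x) = (qnorm z * fst y, qnorm z * snd y)"
    using assms(2) * by metis
  then show ?thesis using assms(1) by (simp add: prod_eq_iff)
qed

text \<open>Take \<open>y\<close> times the inverse of \<open>x\<close>, where the inverse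
  \<open>?w\<close> is the conjugate divided by the norm. For points of equal norm the factor has
  norm 1, so rotations are transitive on such a circle.\<close>

lemma ex_cmul_eq:
  assumes "qnorm x \<noteq> 0"
  obtains z where "cmul z x = y" and "qnorm z = qnorm y / qnorm x"
proof
  let ?w = "(fst x / qnorm x, - snd x / qnorm x)"
  show "cmul (cmul y ?w) x = y"
  proof -
    define q where "q = qnorm x"
    have "fst x * fst x + snd x * snd x = q" "q \<noteq> 0"
      using assms by (simp_all add: q_def qnorm_def power2_eq_square)
    then have "cmul ?w x = (1, 0)"
      unfolding q_def[symmetric] by (simp add: cmul_def mult.commute flip: add_divide_distrib)
    moreover have "cmul (cmul y ?w) x = cmul y (cmul ?w x)"
      unfolding q_def[symmetric] by (simp add: cmul_def algebra_simps)
    ultimately show ?thesis by (simp only:) (simp add: cmul_def)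
  qed
  have "qnorm ?w = qnorm x / (qnorm x)\<^sup>2"
    by (simp add: qnorm_def power_divide add_divide_distrib)
  then show "qnorm (cmul y ?w) = qnorm y / qnorm x"
    using assms by (simp add: qnorm_cmul power2_eq_square)
qed

text \<open>Multiplication by an element of norm \<open>l / k\<close> embeds one circle into the
  other. Exchanging the roles of \<open>k\<close> and \<open>l\<close> gives equal sizes.\<close>

lemma card_circle_le:
  fixes k l :: "'a::{field,finite}"
  assumes "k \<noteq> 0" "l \<noteq> 0" "circle k \<noteq> {}" "circle l \<noteq> {}"
  shows "card (circle k) \<le> card (circle l)"
proof -
  obtain x y where x: "qnorm x = k" and y: "qnorm y = l"
    using assms(3,4) by (metis circle_iff ex_in_conv)
  obtain z where z: "qnorm z = l / k"
    using ex_cmul_eq[of x y] x y assms(1) by metis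
  show ?thesis
  proof (rule card_inj_on_le[of "cmul z"])
    show "inj_on (cmul z) (circle k)"
      using z assms by (auto intro!: inj_onI dest!: cmul_cancel[rotated])
    show "cmul z ` circle k \<subseteq> circle l"
      using z assms by (auto simp: circle_iff qnorm_cmul)
  qed simp
qed

text \<open>The rotation taking \<open>x\<close> to \<open>y\<close> maps the steps from \<open>x\<close> into \<open>C\<^sub>j\<close> to those from \<open>y\<close>.\<close>

lemma card_steps_le:
  fixes x y :: "'a::{field,finite} \<times> 'a"
  assumes "qnorm x = qnorm y" "qnorm x \<noteq> 0"
  shows "card {b \<in> circle 1. x + b \<in> circle j} \<le> card {b \<in> circle 1. y + b \<in> circle j}"
proof -
  obtain z where z: "cmul z x = y" "qnorm z = 1"
    using ex_cmul_eq[of x y] assms by (metis divide_self)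
  show ?thesis
  proof (rule card_inj_on_le[of "cmul z"])
    show "inj_on (cmul z) {b \<in> circle 1. x + b \<in> circle j}"
      using z by (auto intro!: inj_onI dest!: cmul_cancel[rotated])
    show "cmul z ` {b \<in> circle 1. x + b \<in> circle j} \<subseteq> {b \<in> circle 1. y + b \<in> circle j}"
    proof -
      have "qnorm (y + cmul z b) = qnorm (x + b)" for b
        using z by (metis cmul_add mult_1 qnorm_cmul)
      then show ?thesis using z(2) by (auto simp: circle_iff qnorm_cmul)
    qed
  qed simp
qed

section \<open>The prime field and the sizes of its circles\<close>

context
  fixes p :: nat and ty :: "'a::{field,finite} itself"
  assumes p: "prime p" "[p = 3] (mod 4)" "CARD('a) = p"
begin

lemma CHAR_eq: "CHAR('a) = p"
proof -
  have "CHAR('a) dvd p"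
    using CHAR_dvd_CARD[where 'a = 'a] p(3) by simp
  then show ?thesis
    using p(1) CHAR_not_1'[where 'a = 'a] by (auto simp: prime_nat_iff)
qed

lemma of_nat_surj: "\<exists>k<p. of_nat k = (x::'a)"
proof -
  have "inj_on (of_nat :: nat \<Rightarrow> 'a) {..<p}"
    by (auto intro!: inj_onI simp: of_nat_eq_iff_cong_CHAR CHAR_eq cong_def)
  then have "card ((of_nat :: nat \<Rightarrow> 'a) ` {..<p}) = CARD('a)"
    using p(3) by (simp add: card_image)
  then have "(of_nat :: nat \<Rightarrow> 'a) ` {..<p} = UNIV"
    by (intro card_subset_eq) auto
  then show ?thesis by (metis UNIV_I imageE lessThan_iff)
qed

lemma p_eq: "\<exists>m. p = 4 * m + 3"
proof -
  have "p mod 4 = 3" using p(2) by (simp add: cong_def)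
  then show ?thesis by presburger
qed

lemma two_neq_0: "(2::'a) \<noteq> 0"
proof
  assume "(2::'a) = 0"
  then have "of_nat 2 = (0::'a)" by simp
  then have "p dvd 2" unfolding of_nat_eq_0_iff_char_dvd CHAR_eq .
  then have "p \<le> 2" by (simp add: dvd_imp_le)
  then show False using p_eq by auto
qed

text \<open>By Fermat, a root of -1 would give 1 = x^(p-1) = (-1)^((p-1)/2), and the exponent
  (p-1)/2 = 2m + 1 is odd.\<close>

lemma minus_one_not_square: "(x::'a)\<^sup>2 \<noteq> -1"
proof
  assume x: "x\<^sup>2 = -1"
  obtain m where m: "p = 4 * m + 3" using p_eq by blast
  obtain k where k: "k < p" "of_nat k = x" using of_nat_surj by blast
  have "k \<noteq> 0" using k(2) x by (metis of_nat_0 power_zero_numeral neg_equal_0_iff_equal zero_neq_one)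
  then have "\<not> p dvd k" using k(1) by (simp add: nat_dvd_not_less)
  then have "[k ^ (p - 1) = 1] (mod p)" by (rule fermat_theorem[OF p(1)])
  then have "of_nat (k ^ (p - 1)) = (of_nat 1 :: 'a)"
    by (simp only: of_nat_eq_iff_cong_CHAR CHAR_eq)
  then have "x ^ (p - 1) = 1" by (simp add: k)
  moreover have "p - 1 = 2 * (2 * m + 1)" using m by simp
  ultimately have "(-1) ^ (2 * m + 1) = (1::'a)" by (simp only: power_mult x)
  then have "-1 = (1::'a)" by simp
  then have "2 = (0::'a)" by (metis add.right_inverse one_add_one)
  with two_neq_0 show False ..
qed

text \<open>For a zero of the form with v nonzero, u/v would be a square root of -1.\<close>

lemma qnorm_eq_0_iff: "qnorm (x :: 'a \<times> 'a) = 0 \<longleftrightarrow> x = 0"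
proof
  obtain u v where x: "x = (u, v)" by fastforce
  assume "qnorm x = 0"
  then have *: "u\<^sup>2 = - v\<^sup>2" by (simp add: x qnorm_def eq_neg_iff_add_eq_0)
  have "v = 0"
  proof (rule ccontr)
    assume "v \<noteq> 0"
    with * have "(u / v)\<^sup>2 = -1" by (simp add: power_divide)
    then show False using minus_one_not_square by blast
  qed
  with * show "x = 0" by (simp add: x zero_prod_def)
qed (simp add: qnorm_def)

lemma circle_0: "circle (0::'a) = {0}"
  by (auto simp: circle_iff qnorm_eq_0_iff)

text \<open>The sets of all \<open>u\<^sup>2\<close> and of all \<open>k - v\<^sup>2\<close> have more than half of the elements each.\<close>

lemma circle_nonempty: "circle (k::'a) \<noteq> {}"
proof
  assume empty: "circle k = {}"
  let ?A = "range (\<lambda>u::'a. u\<^sup>2)" and ?B = "range (\<lambda>v::'a. k - v\<^sup>2)"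
  have fib: "card {u. u\<^sup>2 = (a::'a)} \<le> 2" for a
  proof (cases "\<exists>w. w\<^sup>2 = a")
    case True
    then obtain w where "w\<^sup>2 = a" by blast
    then have "{u. u\<^sup>2 = a} \<subseteq> {w, -w}" by (auto simp: power2_eq_iff)
    then have "card {u. u\<^sup>2 = a} \<le> card {w, -w}" by (intro card_mono) auto
    also have "\<dots> \<le> 2" by (simp add: card_insert_if)
    finally show ?thesis .
  qed simp
  have "CARD('a) = (\<Sum>a\<in>?A. card {u. u\<^sup>2 = a})"
    using sum.group[of "UNIV :: 'a set" ?A "\<lambda>u. u\<^sup>2" "\<lambda>_. 1 :: nat"] by simp
  also have "\<dots> \<le> (\<Sum>a\<in>?A. 2)" by (intro sum_mono fib)
  finally have "p \<le> 2 * card ?A" using p(3) by simp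
  \<comment> \<open>The inequality is strict because p is odd.\<close>
  then have A: "p < 2 * card ?A" using p_eq by presburger
  have "?B = (\<lambda>a. k - a) ` ?A" by auto
  then have B: "card ?B = card ?A" by (simp add: card_image inj_on_def)
  have "?A \<inter> ?B = {}"
  proof (rule ccontr)
    assume "?A \<inter> ?B \<noteq> {}"
    then obtain u v :: 'a where "u\<^sup>2 = k - v\<^sup>2" by blast
    then have "(u, v) \<in> circle k" by (simp add: circle_def)
    with empty show False by simp
  qed
  then have "card ?A + card ?B = card (?A \<union> ?B)" by (simp add: card_Un_disjoint)
  also have "\<dots> \<le> p" using card_mono[of UNIV "?A \<union> ?B"] p(3) by simp
  finally show False using A B by simp
qed

text \<open>The circles partition the p^2 points of the plane: one is a single point and the other p
  - 1 share a common size c. Hence p^2 = 1 + (p - 1) c, which forces c = p + 1.\<close>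

lemma card_circle: "(k::'a) \<noteq> 0 \<Longrightarrow> card (circle k) = p + 1"
proof -
  have eq: "card (circle l) = card (circle (1::'a))" if "l \<noteq> 0" for l :: 'a
    by (intro antisym card_circle_le circle_nonempty that) simp_all
  have "p * p = card (UNIV :: ('a \<times> 'a) set)"
    using p(3) by simp
  also have "\<dots> = (\<Sum>k::'a\<in>UNIV. card (circle k))"
    using sum.group[of "UNIV :: ('a \<times> 'a) set" "UNIV :: 'a set" qnorm "\<lambda>_. 1 :: nat"]
    by (simp add: circle_iff[symmetric] del: mem_Collect_eq)
  also have "\<dots> = 1 + (\<Sum>k::'a\<in>UNIV - {0}. card (circle k))"
    by (subst sum.remove[of _ 0]) (simp_all add: circle_0)
  also have "(\<Sum>k::'a\<in>UNIV - {0}. card (circle k)) = (\<Sum>k::'a\<in>UNIV - {0}. card (circle (1::'a)))"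
    by (intro sum.cong eq) auto
  also have "\<dots> = (p - 1) * card (circle (1::'a))"
    using p(3) by simp
  finally have "(p - 1) * (p + 1) = (p - 1) * card (circle (1::'a))"
    by (simp add: algebra_simps)
  moreover have "p - 1 > 0" using p_eq by auto
  ultimately have "card (circle (1::'a)) = p + 1" by (metis mult_left_cancel less_not_refl)
  then show "card (circle k) = p + 1" if "k \<noteq> 0" using eq[OF that] by simp
qed

lemma card_steps_eq:
  fixes x y :: "'a \<times> 'a"
  assumes "qnorm x = qnorm y"
  shows "card {b \<in> circle 1. x + b \<in> circle j} = card {b \<in> circle 1. y + b \<in> circle j}"
proof (cases "qnorm x = 0")
  case True
  then have "x = 0" "y = 0" using assms by (metis qnorm_eq_0_iff)+
  then show ?thesis by simp
next
  case False
  then show ?thesis using assms by (intro antisym card_steps_le) auto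
qed

text \<open>The number of steps into \<open>circle j\<close> is the same from every point of
  \<open>circle i\<close>, so averaging over the starting point changes nothing. This is what makes
  the walk in the plane project to a Markov chain on circles.\<close>

lemma n_coeff_eq:
  fixes x :: "'a \<times> 'a"
  assumes "x \<in> circle i"
  shows "n_coeff i 1 j = real (card {b \<in> circle 1. x + b \<in> circle j}) / real (card (circle (1::'a)))"
proof -
  have "{(a, b) \<in> circle i \<times> circle 1. a + b \<in> circle j}
      = (SIGMA a:circle i. {b \<in> circle 1. a + b \<in> circle j})"
    by auto
  then have "N_coeff i 1 j = (\<Sum>a\<in>circle i. card {b \<in> circle 1. a + b \<in> circle j})"
    by (simp add: N_coeff_def)
  also have "\<dots> = (\<Sum>a\<in>circle i. card {b \<in> circle 1. x + b \<in> circle j})"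
    using assms by (intro sum.cong refl card_steps_eq) (simp add: circle_iff)
  also have "\<dots> = card (circle i) * card {b \<in> circle 1. x + b \<in> circle j}" by simp
  finally show ?thesis
    using circle_nonempty[of i] by (simp add: n_coeff_def)
qed

section \<open>Reaching every point in a fixed number of unit steps\<close>

lemma step_rel_line:
  fixes u v :: 'a
  assumes "(a, b) \<in> circle 1"
  shows "((u, v), (u + of_nat k * a, v + of_nat k * b)) \<in> step_rel (circle 1) ^^ k"
proof (induction k)
  case (Suc k)
  have "((u + of_nat k * a, v + of_nat k * b), (u + of_nat (Suc k) * a, v + of_nat (Suc k) * b))
      \<in> step_rel (circle 1)"
    using assms by (simp add: step_rel_def distrib_right)
  with Suc show ?case by (rule relpow_Suc_I)
qed simp

text \<open>With k plus signs and p - 1 - k minus signs the sum is 2k + 1 modulo p; solving for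
  \<open>d\<close> gives k = (d - 1)/2.\<close>

lemma sum_signs_surj: "\<exists>k l. k + l = p - 1 \<and> of_nat k - of_nat l = (d::'a)"
proof -
  obtain k where k: "k < p" "of_nat k = (d - 1) / 2" using of_nat_surj by blast
  have "of_nat k + of_nat (p - 1 - k) + 1 = (of_nat p :: 'a)"
  proof -
    have "k + (p - 1 - k) + 1 = p" using k(1) by simp
    then show ?thesis by (metis of_nat_1 of_nat_add)
  qed
  moreover have "of_nat p = (0::'a)" by (simp add: of_nat_eq_0_iff_char_dvd CHAR_eq)
  ultimately have "of_nat (p - 1 - k) = - (1 + of_nat k :: 'a)"
    by (simp add: algebra_simps eq_neg_iff_add_eq_0)
  then have "of_nat k - of_nat (p - 1 - k) = 2 * (of_nat k :: 'a) + 1" by simp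
  also have "\<dots> = d" unfolding k(2) using two_neq_0
    by (metis diff_add_cancel nonzero_mult_div_cancel_left times_divide_eq_right)
  finally show ?thesis using k(1) by (intro exI[of _ k] exI[of _ "p - 1 - k"]) auto
qed

text \<open>The path uses p - 1 horizontal steps (1,0) or (-1,0) to correct the first coordinate,
  then p - 1 vertical ones for the second. The length does not depend on the endpoints.\<close>

lemma step_rel_reach_all:
  fixes x y :: "'a \<times> 'a"
  shows "(x, y) \<in> step_rel (circle 1) ^^ ((p - 1) + (p - 1))"
proof -
  obtain u v s t where xy: "x = (u, v)" "y = (s, t)" by fastforce
  obtain k l where kl: "k + l = p - 1" "of_nat k - of_nat l = s - u"
    using sum_signs_surj by blast
  obtain k' l' where kl': "k' + l' = p - 1" "of_nat k' - of_nat l' = t - v"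
    using sum_signs_surj by blast
  let ?R = "step_rel (circle (1::'a))"
  have "((u, v), (u + of_nat k, v)) \<in> ?R ^^ k"
    using step_rel_line[of 1 0 u v k] by (simp add: circle_def)
  moreover have "((u + of_nat k, v), (s, v)) \<in> ?R ^^ l"
    using step_rel_line[of "-1" 0 "u + of_nat k" v l] kl(2) by (simp add: circle_def algebra_simps)
  ultimately have 1: "((u, v), (s, v)) \<in> ?R ^^ (p - 1)"
    unfolding kl(1)[symmetric] relpow_add by (rule relcompI)
  have "((s, v), (s, v + of_nat k')) \<in> ?R ^^ k'"
    using step_rel_line[of 0 1 s v k'] by (simp add: circle_def)
  moreover have "((s, v + of_nat k'), (s, t)) \<in> ?R ^^ l'"
    using step_rel_line[of 0 "-1" s "v + of_nat k'" l'] kl'(2)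
    by (simp add: circle_def algebra_simps)
  ultimately have 2: "((s, v), (s, t)) \<in> ?R ^^ (p - 1)"
    unfolding kl'(1)[symmetric] relpow_add by (rule relcompI)
  show ?thesis
    unfolding relpow_add xy using 1 2 by (rule relcompI)
qed

lemma funpow_avg_step_circle_tendsto:
  fixes x :: "'a \<times> 'a"
  shows "(\<lambda>n. (avg_step (circle 1) ^^ n) (indicator (circle j)) x) \<longlonglongrightarrow> circle_stationary j"
proof -
  have "(\<Sum>y::'a \<times> 'a\<in>UNIV. indicator (circle j) y :: real) = real (card (circle j))"
    by (simp add: indicator_def)
  then have "(\<Sum>y::'a \<times> 'a\<in>UNIV. indicator (circle j) y) / real CARD('a \<times> 'a) = circle_stationary j"
    using card_circle[of j] p(3)
    by (simp add: circle_stationary_def circle_0 power2_eq_square)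
  then show ?thesis
    using funpow_avg_step_tendsto_mean[OF circle_nonempty step_rel_reach_all] by metis
qed

end

section \<open>The two chains as iterates of the averaging operator\<close>

text \<open>The definition appends the last step on the right; splitting off the first step instead
  matches the outermost \<open>avg_step\<close> of the iterate.\<close>

lemma circle_kernel_pow_Suc:
  "circle_kernel_pow (Suc n) = (circle_kernel :: real ^ 'a::{field,finite} ^ 'a::{field,finite}) ** circle_kernel_pow n"
proof (induction n)
  case (Suc n)
  have "(circle_kernel_pow (Suc (Suc n)) :: real ^ 'a::{field,finite} ^ 'a::{field,finite}) = circle_kernel_pow (Suc n) ** circle_kernel"
    by (simp add: circle_kernel_pow_def)
  also have "\<dots> = circle_kernel ** (circle_kernel_pow n ** circle_kernel)"
    by (simp only: Suc.IH matrix_mul_assoc)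
  finally show ?case by (simp add: circle_kernel_pow_def)
qed (simp add: circle_kernel_pow_def)

lemma circle_kernel_pow_eq:
  fixes x :: "'a::{field,finite} \<times> 'a"
  assumes p: "prime p" "[p = 3] (mod 4)" "CARD('a) = p"
    and "x \<in> circle i"
  shows "circle_kernel_pow n $ i $ j = (avg_step (circle 1) ^^ n) (indicator (circle j)) x"
  using assms(4)
proof (induction n arbitrary: i x)
  case 0
  then show ?case by (auto simp: circle_kernel_pow_def mat_def circle_iff)
next
  case (Suc n)
  have "circle_kernel_pow (Suc n) $ i $ j = (\<Sum>k\<in>UNIV. n_coeff i 1 k * circle_kernel_pow n $ k $ j)"
    by (simp add: circle_kernel_pow_Suc matrix_matrix_mult_def circle_kernel_def)
  also have "\<dots> = (\<Sum>k\<in>UNIV. \<Sum>b | b \<in> circle 1 \<and> x + b \<in> circle k.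
      circle_kernel_pow n $ k $ j) / real (card (circle (1::'a)))"
    by (simp add: n_coeff_eq[OF p Suc.prems] sum_divide_distrib)
  \<comment> \<open>The induction hypothesis may be used at any point of \<open>circle k\<close>;
    the choice is \<open>x + b\<close>. Since each \<open>x + b\<close> lies on exactly one circle,
    the double sum then collapses to a sum over \<open>b\<close>.\<close>
  also have "(\<Sum>k\<in>UNIV. \<Sum>b | b \<in> circle 1 \<and> x + b \<in> circle k. circle_kernel_pow n $ k $ j)
      = (\<Sum>k\<in>UNIV. \<Sum>b | b \<in> circle 1 \<and> qnorm (x + b) = k.
          (avg_step (circle 1) ^^ n) (indicator (circle j)) (x + b))"
    by (intro sum.cong) (auto simp: circle_iff intro!: Suc.IH)
  also have "\<dots> = (\<Sum>b\<in>circle 1. (avg_step (circle 1) ^^ n) (indicator (circle j)) (x + b))"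
    using sum.group[of "circle 1 :: ('a \<times> 'a) set" UNIV "\<lambda>b. qnorm (x + b)"] by simp
  finally show ?case by (simp add: avg_step_def[of _ "(avg_step _ ^^ n) _"])
qed

section \<open>The law of the random walk\<close>

lemma measurable_add_count_space:
  fixes f g :: "'w \<Rightarrow> 'g::{ab_group_add,finite}"
  assumes "f \<in> measurable M (count_space UNIV)" "g \<in> measurable M (count_space UNIV)"
  shows "(\<lambda>x. f x + g x) \<in> measurable M (count_space UNIV)"
proof (rule measurable_compose_countable'[where f = "\<lambda>a x. a + g x", OF _ assms(1)])
  show "(\<lambda>x. a + g x) \<in> measurable M (count_space UNIV)" for a
    by (rule measurable_compose[OF assms(2)]) simp
qed (simp add: countable_finite)

lemma measurable_sum_count_space:
  fixes f :: "'i \<Rightarrow> 'w \<Rightarrow> 'g::{ab_group_add,finite}"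
  assumes "\<And>i. i \<in> I \<Longrightarrow> f i \<in> measurable M (count_space UNIV)"
  shows "(\<lambda>x. \<Sum>i\<in>I. f i x) \<in> measurable M (count_space UNIV)"
  using assms
  by (induction I rule: infinite_finite_induct) (auto intro: measurable_add_count_space)

text \<open>Splitting by the value of \<open>Y\<close> gives disjoint events, and independence
  factors each of them: the law of the sum is a convolution.\<close>

lemma (in prob_space) prob_add_eq:
  fixes X Y :: "'a \<Rightarrow> 'g::{ab_group_add,finite}"
  assumes "indep_var (count_space UNIV) X (count_space UNIV) Y"
  shows "prob {\<omega> \<in> space M. X \<omega> + Y \<omega> = y} =
    (\<Sum>b\<in>UNIV. prob {\<omega> \<in> space M. X \<omega> = y - b} * prob {\<omega> \<in> space M. Y \<omega> = b})"
proof -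
  have [measurable]: "X \<in> measurable M (count_space UNIV)" "Y \<in> measurable M (count_space UNIV)"
    using indep_var_rv1[OF assms] indep_var_rv2[OF assms] by auto
  have "{\<omega> \<in> space M. X \<omega> + Y \<omega> = y} = (\<Union>b. {\<omega> \<in> space M. X \<omega> = y - b \<and> Y \<omega> = b})"
    by (auto simp: algebra_simps)
  also have "prob \<dots> = (\<Sum>b\<in>UNIV. prob {\<omega> \<in> space M. X \<omega> = y - b \<and> Y \<omega> = b})"
    by (rule finite_measure_finite_Union) (auto simp: disjoint_family_on_def)
  also have "\<dots> = (\<Sum>b\<in>UNIV. prob {\<omega> \<in> space M. X \<omega> = y - b} * prob {\<omega> \<in> space M. Y \<omega> = b})"
  proof (rule sum.cong[OF refl])
    fix b
    show "prob {\<omega> \<in> space M. X \<omega> = y - b \<and> Y \<omega> = b} =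
        prob {\<omega> \<in> space M. X \<omega> = y - b} * prob {\<omega> \<in> space M. Y \<omega> = b}"
      using indep_varD[OF assms, of "{y - b}" "{b}"]
      by (simp add: vimage_def Int_def conj_commute)
  qed
  finally show ?thesis .
qed

text \<open>The two variables are functions of the subfamilies indexed by the disjoint sets
  \<open>{1..n}\<close> and \<open>{Suc n}\<close>.\<close>

lemma (in prob_space) indep_var_walk_step:
  fixes U :: "nat \<Rightarrow> 'a \<Rightarrow> 'f::{field,finite} \<times> 'f"
  assumes "indep_vars (\<lambda>_. count_space UNIV) U {1..}"
  shows "indep_var (count_space UNIV) (walk U n) (count_space UNIV) (U (Suc n))"
proof -
  have "indep_var (count_space UNIV) ((\<lambda>w. \<Sum>i=1..n. w i) \<circ> (\<lambda>\<omega>. restrict (\<lambda>i. U i \<omega>) {1..n}))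
      (count_space UNIV) ((\<lambda>w. w (Suc n)) \<circ> (\<lambda>\<omega>. restrict (\<lambda>i. U i \<omega>) {Suc n}))"
    by (rule indep_var_compose[OF indep_var_restrict[OF assms]])
      (auto intro!: measurable_sum_count_space measurable_component_singleton)
  moreover have "(\<lambda>w. \<Sum>i=1..n. w i) \<circ> (\<lambda>\<omega>. restrict (\<lambda>i. U i \<omega>) {1..n}) = walk U n"
    by (auto simp: fun_eq_iff walk_def)
  moreover have "(\<lambda>w. w (Suc n)) \<circ> (\<lambda>\<omega>. restrict (\<lambda>i. U i \<omega>) {Suc n}) = U (Suc n)"
    by (auto simp: fun_eq_iff)
  ultimately show ?thesis by simp
qed

text \<open>The left side is the expectation of h(X_n). The induction removes the last step from the
  law and passes it to the test function, E h(X_{n+1}) = E (T h)(X_n), hence the generalisation over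
  \<open>h\<close>.\<close>

lemma (in prob_space) expectation_walk:
  fixes U :: "nat \<Rightarrow> 'a \<Rightarrow> 'f::{field,finite} \<times> 'f"
  assumes indep: "indep_vars (\<lambda>_. count_space UNIV) U {1..}"
    and unif: "\<And>i. i \<ge> 1 \<Longrightarrow>
      distr M (count_space UNIV) (U i) = measure_pmf (pmf_of_set (circle 1))"
  shows "(\<Sum>y\<in>UNIV. prob {\<omega> \<in> space M. walk U n \<omega> = y} * h y) = (avg_step (circle 1) ^^ n) h 0"
proof (induction n arbitrary: h)
  case 0
  have "prob {\<omega> \<in> space M. walk U 0 \<omega> = y} = (if y = 0 then 1 else 0)" for y
    by (auto simp: walk_def prob_space)
  then show ?case by (simp add: if_distrib[of "\<lambda>z. z * _"] cong: if_cong)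
next
  case (Suc n)
  let ?C = "circle (1::'f)"
  let ?\<mu> = "\<lambda>n y. prob {\<omega> \<in> space M. walk U n \<omega> = y}"
  have ne: "?C \<noteq> {}"
  proof -
    have "(1, 0) \<in> ?C" by (simp add: circle_def)
    then show ?thesis by blast
  qed
  have meas: "U (Suc n) \<in> measurable M (count_space UNIV)"
    using indep_var_rv2[OF indep_var_walk_step[OF indep]] by simp
  have step: "prob {\<omega> \<in> space M. U (Suc n) \<omega> = b} = indicator ?C b / real (card ?C)" for b
  proof -
    have "prob {\<omega> \<in> space M. U (Suc n) \<omega> = b} = measure (distr M (count_space UNIV) (U (Suc n))) {b}"
      by (subst measure_distr[OF meas]) (auto intro!: arg_cong[where f = prob])
    also have "\<dots> = pmf (pmf_of_set ?C) b" by (simp add: unif measure_pmf_single)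
    finally show ?thesis using ne by simp
  qed
  \<comment> \<open>This substitution carries the translation by \<open>b\<close> from the law over
    to \<open>h\<close>.\<close>
  have shift: "(\<Sum>y\<in>UNIV. ?\<mu> n (y - b) * h y) = (\<Sum>y\<in>UNIV. ?\<mu> n y * h (y + b))" for b
    by (rule sum.reindex_bij_witness[of _ "\<lambda>y. y + b" "\<lambda>y. y - b"]) auto
  have rec: "?\<mu> (Suc n) y = (\<Sum>b\<in>?C. ?\<mu> n (y - b) / real (card ?C))" for y
  proof -
    have "?\<mu> (Suc n) y = (\<Sum>b\<in>UNIV. ?\<mu> n (y - b) * (indicator ?C b / real (card ?C)))"
      using prob_add_eq[OF indep_var_walk_step[OF indep], of n y]
      by (simp add: walk_def step)
    also have "\<dots> = (\<Sum>b\<in>?C. ?\<mu> n (y - b) * (indicator ?C b / real (card ?C)))"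
      by (intro sum.mono_neutral_right) auto
    finally show ?thesis by simp
  qed
  have "(\<Sum>y\<in>UNIV. ?\<mu> (Suc n) y * h y)
      = (\<Sum>y\<in>UNIV. \<Sum>b\<in>?C. ?\<mu> n (y - b) * h y / real (card ?C))"
    by (simp add: rec sum_distrib_right)
  also have "\<dots> = (\<Sum>b\<in>?C. (\<Sum>y\<in>UNIV. ?\<mu> n (y - b) * h y) / real (card ?C))"
    by (subst sum.swap) (simp add: sum_divide_distrib)
  also have "\<dots> = (\<Sum>y\<in>UNIV. \<Sum>b\<in>?C. ?\<mu> n y * h (y + b) / real (card ?C))"
    unfolding shift by (subst sum.swap) (simp add: sum_divide_distrib)
  also have "\<dots> = (\<Sum>y\<in>UNIV. ?\<mu> n y * avg_step ?C h y)"
    by (simp add: avg_step_def sum_distrib_left sum_divide_distrib)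
  also have "\<dots> = (avg_step ?C ^^ Suc n) h 0"
    by (simp only: Suc funpow_Suc_right o_def)
  finally show ?case .
qed

lemma (in prob_space) alpha_eq:
  fixes U :: "nat \<Rightarrow> 'a \<Rightarrow> 'f::{field,finite} \<times> 'f"
  assumes indep: "indep_vars (\<lambda>_. count_space UNIV) U {1..}"
    and unif: "\<And>i. i \<ge> 1 \<Longrightarrow>
      distr M (count_space UNIV) (U i) = measure_pmf (pmf_of_set (circle 1))"
  shows "alpha M U n j = (avg_step (circle 1) ^^ n) (indicator (circle j)) 0"
proof -
  have [measurable]: "walk U n \<in> measurable M (count_space UNIV)"
    using indep_var_rv1[OF indep_var_walk_step[OF indep]] .
  have "{\<omega> \<in> space M. walk U n \<omega> \<in> circle j} = (\<Union>y\<in>circle j. {\<omega> \<in> space M. walk U n \<omega> = y})"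
    by auto
  then have "alpha M U n j = (\<Sum>y\<in>circle j. prob {\<omega> \<in> space M. walk U n \<omega> = y})"
    unfolding alpha_def
    by (simp only:) (rule finite_measure_finite_Union, auto simp: disjoint_family_on_def)
  also have "\<dots> = (\<Sum>y\<in>UNIV. prob {\<omega> \<in> space M. walk U n \<omega> = y} * indicator (circle j) y)"
    by (simp add: indicator_def if_distrib[of "(*) _"] sum.If_cases)
  finally show ?thesis by (simp only: expectation_walk[OF assms])
qed

theorem theorem4:
  fixes p :: nat
    and M :: "'w measure"
    and U :: "nat \<Rightarrow> 'w \<Rightarrow> 'a::{field,finite} \<times> 'a"
  assumes "prime p"
    and "[p = 3] (mod 4)"
    and "CARD('a) = p"
    and "prob_space M"
    and "prob_space.indep_vars M (\<lambda>_. count_space UNIV) U {1..}"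
    and "\<And>i. i \<ge> 1 \<Longrightarrow>
           distr M (count_space UNIV) (U i) = measure_pmf (pmf_of_set (circle 1))"
  shows "(\<lambda>n. c1_power M U n) \<longlonglongrightarrow>
           (1 / (real p)\<^sup>2) *\<^sub>R circle_sym 0 +
           ((real p + 1) / (real p)\<^sup>2) *\<^sub>R (\<Sum>j\<in>UNIV - {0}. circle_sym j)
       \<and> (\<lambda>n. alpha M U n 0) \<longlonglongrightarrow> 1 / (real p)\<^sup>2
       \<and> (\<forall>j. j \<noteq> 0 \<longrightarrow> (\<lambda>n. alpha M U n j) \<longlonglongrightarrow> (real p + 1) / (real p)\<^sup>2)
       \<and> (\<forall>i j::'a. (\<lambda>n. circle_kernel_pow n $ i $ j) \<longlonglongrightarrow> circle_stationary j)"
proof -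
  note p = assms(1-3)
  have alpha: "(\<lambda>n. alpha M U n j) \<longlonglongrightarrow> circle_stationary j" for j
  proof -
    have "alpha M U n j = (avg_step (circle 1) ^^ n) (indicator (circle j)) 0" for n
      by (rule prob_space.alpha_eq[OF assms(4,5)]) (rule assms(6))
    then show ?thesis using funpow_avg_step_circle_tendsto[OF p] by simp
  qed
  have "(\<lambda>n. c1_power M U n) \<longlonglongrightarrow> (\<Sum>j\<in>UNIV. circle_stationary j *\<^sub>R circle_sym j)"
    unfolding c1_power_def by (intro tendsto_intros alpha)
  also have "(\<Sum>j\<in>UNIV. circle_stationary j *\<^sub>R circle_sym j) =
      (1 / (real p)\<^sup>2) *\<^sub>R circle_sym (0::'a) +
      (\<Sum>j\<in>UNIV - {0}. ((real p + 1) / (real p)\<^sup>2) *\<^sub>R circle_sym j)"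
    by (subst sum.remove[of _ 0]) (simp_all add: circle_stationary_def p(3))
  also have "(\<Sum>j\<in>UNIV - {0::'a}. ((real p + 1) / (real p)\<^sup>2) *\<^sub>R circle_sym j) =
      ((real p + 1) / (real p)\<^sup>2) *\<^sub>R (\<Sum>j\<in>UNIV - {0}. circle_sym j)"
    by (simp only: scaleR_sum_right)
  finally have c1: "(\<lambda>n. c1_power M U n) \<longlonglongrightarrow>
      (1 / (real p)\<^sup>2) *\<^sub>R circle_sym 0 +
      ((real p + 1) / (real p)\<^sup>2) *\<^sub>R (\<Sum>j\<in>UNIV - {0}. circle_sym j)" .
  have kernel: "(\<lambda>n. circle_kernel_pow n $ i $ j) \<longlonglongrightarrow> circle_stationary j" for i j :: 'a
  proof -
    \<comment> \<open>The kernel row of \<open>i\<close> is read off at a point of its circle, so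
      that circle has to be non-empty.\<close>
    obtain x where "x \<in> circle i" using circle_nonempty[OF p] by blast
    then show ?thesis
      using funpow_avg_step_circle_tendsto[OF p] by (simp add: circle_kernel_pow_eq[OF p])
  qed
  have "(\<lambda>n. alpha M U n j) \<longlonglongrightarrow> (real p + 1) / (real p)\<^sup>2" if "j \<noteq> 0" for j
    using alpha[of j] that by (simp add: circle_stationary_def p(3))
  moreover have "(\<lambda>n. alpha M U n 0) \<longlonglongrightarrow> 1 / (real p)\<^sup>2"
    using alpha[of 0] by (simp add: circle_stationary_def p(3))
  ultimately show ?thesis
    using c1 kernel by blast
qed

end
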